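(* Let $X$ be a finite augmented semi-simplicial set and let $a$ be a finitely supported augmented integer sequence. Then: (i) $|\mathrm{Sd}(X)| = |X\,\widetilde{\vartriangleright}\,\mathrm{Sd}| = |X|\,\widetilde{\triangleright}\,|\mathrm{Sd}|$; (ii) $\mathrm{sd}:=|\mathrm{Sd}| = \mathrm{cad}^+$; (iii) $\mathrm{sd}(a) = a\,\widetilde{\triangleright}\,\mathrm{sd} = a\cdot \breve{\mathrm{sd}}$, where $\breve{\mathrm{sd}}:=\breve{\mathrm{cad}}^+$. In particular $|\mathrm{Sd}(X)| = \mathrm{sd}(|X|)$ for every finite augmented semi-simplicial set $X$.
   Context: Let $\mathbf{\Gamma}_+$ be the category with objects $[n]=\{0<1<\dots<n\}$ for $n\ge 0$ and $[-1]=\emptyset$, and morphisms the strictly increasing maps. An augmented semi-simplicial set is a functor $X:\mathbf{\Gamma}_+^{op}\to\mathbf{Sets}$; write $X_m=X([m])$ for $m\ge -1$. $X$ is finite if each $X_m$ is finite and $X_m=\emptyset$ for all large $m$. Its sequential cardinal is the augmented sequence $|X|=(|X_{-1}|,|X_0|,|X_1|,\dots)$. For a functor $Z:\mathbf{\Gamma}_+\to\mathbf{Sets}^{\mathbf{\Gamma}_+^{op}}$, the action $X\,\widetilde{\vartriangleright}\,Z$ is the colimit of $Z\circ\pi_X$ over the category of elements of $X$ (objects $([n],x)$ with $x\in X_n$; morphisms $([n],x)\to([n'],x')$ are $\varphi:[n]\to[n']$ with $X(\varphi)(x')=x$; $\pi_X([n],x)=[n]$); equivalently it is the colimit-preserving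 extension of $Z$ along the Yoneda embedding $[n]\mapsto\Gamma_+[n]=\mathrm{Hom}_{\mathbf{\Gamma}_+}(-,[n])$. If all $Z([n])_m$ are finite, $|Z|$ denotes the matrix $(|Z([n])_m|)_{n,m\ge -1}$. Sd: for $n\ge -1$, $\mathrm{Sd}\Gamma_+[n]_m$ (for $-1\le m\le n$) is the set of chains of composable morphisms $\emptyset=[-1]\xrightarrow{\varphi_{-1}}[k_0]\xrightarrow{\varphi_0}[k_1]\to\cdots\xrightarrow{\varphi_{m-1}}[k_m]\xrightarrow{\varphi_m}[n]$ in $\mathbf{\Gamma}_+$ with $0\le k_0<k_1<\dots<k_m\le n$, and is empty for $m>n$; the face $d_i$ ($0\le i\le m$) replaces $\varphi_{i-1},\varphi_i$ by the composite $\varphi_i\circ\varphi_{i-1}$ (i.e. deletes $[k_i]$). A morphism $[n]\to[n']$ acts by postcomposition on the last map. This gives $\mathrm{Sd}:\mathbf{\Gamma}_+\to\mathbf{Sets}^{\mathbf{\Gamma}_+^{op}}$, and $\mathrm{Sd}(X):=X\,\widetilde{\vartriangleright}\,\mathrm{Sd}$. Sequences and matrices are indexed by $\mathbb{N}_+=\{-1,0,1,\dots\}$; $(a\cdot B)_j=\sum_k a_kB_{k,j}$, $(A\cdot B)_{i,j}=\sum_kA_{i,k}B_{k,j}$. $\mathrm{bin}_{i,j}=\binom{i+1}{j+1}$ (zero if $j>i$), with inverse $\mathrm{bin}^{-1}_{i,j}=(-1)^{i-j}\binom{i+1}{j+1}$. For finitely supported $a$ and any matrix $B$, $a\,\widetilde{\triangleright}\,B:=(a\cdot\mathrm{bin}^{-1})\cdot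 B$. Chain numbers: $\mathrm{cad}^+[n]_p$ is the number of chains $\emptyset=N_{-1}\subsetneq N_0\subsetneq\dots\subsetneq N_p\subseteq[n]$ of subsets, and $\breve{\mathrm{cad}}^+[n]_p$ the number of such chains with $N_p=[n]$ ($n,p\ge -1$); $\mathrm{cad}^+$ and $\breve{\mathrm{cad}}^+$ are the matrices with $(n,p)$ entries these numbers. For finitely supported $a$, $\mathrm{sd}(a):=a\,\widetilde{\triangleright}\,\mathrm{cad}^+$. *)

theory Defs
  imports Main "HOL-Library.FuncSet" "HOL-Library.Groups_Big_Fun"
begin

text \<open>
  Indexing convention: the index set \<open>{-1, 0, 1, \<dots>}\<close> is represented by \<^typ>\<open>nat\<close>, shifted by one.
  The natural number \<open>n\<close> stands for the index \<open>n - 1\<close>, and in particular for the object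
  \<open>[n - 1] = {0 < \<dots> < n - 1}\<close>, which is the set \<open>{..<n}\<close> with \<open>n\<close> elements; \<open>0\<close> stands for
  \<open>[-1] = {}\<close>.
\<close>

section \<open>Augmented semi-simplicial sets\<close>

definition Gam :: "nat \<Rightarrow> nat \<Rightarrow> (nat \<Rightarrow> nat) set" where
  "Gam m n = {\<phi> \<in> {..<m} \<rightarrow>\<^sub>E {..<n}. strict_mono_on {..<m} \<phi>}"

definition Gam_id :: "nat \<Rightarrow> nat \<Rightarrow> nat" where
  "Gam_id n = (\<lambda>i\<in>{..<n}. i)"

text \<open>
  \<open>face X m n \<phi>\<close> is the map \<open>X(\<phi>) : X\<^sub>n \<rightarrow> X\<^sub>m\<close> for a morphism \<open>\<phi>\<close> from \<open>m\<close> to \<open>n\<close>; its values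
  outside \<open>X\<^sub>n\<close> are irrelevant. An extensional function does not determine its source and target,
  so they are passed explicitly.
\<close>

record 'a aug_sset =
  cells :: "nat \<Rightarrow> 'a set"
  face :: "nat \<Rightarrow> nat \<Rightarrow> (nat \<Rightarrow> nat) \<Rightarrow> 'a \<Rightarrow> 'a"

definition is_aug_sset :: "'a aug_sset \<Rightarrow> bool" where
  "is_aug_sset X \<longleftrightarrow>
     (\<forall>m n. \<forall>\<phi>\<in>Gam m n. face X m n \<phi> \<in> cells X n \<rightarrow> cells X m) \<and>
     (\<forall>n. \<forall>x\<in>cells X n. face X n n (Gam_id n) x = x) \<and>
     (\<forall>l m n. \<forall>\<phi>\<in>Gam l m. \<forall>\<psi>\<in>Gam m n. \<forall>x\<in>cells X n.
        face X l n (compose {..<l} \<psi> \<phi>) x = face X l m \<phi> (face X m n \<psi> x))"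

definition finite_aug_sset :: "'a aug_sset \<Rightarrow> bool" where
  "finite_aug_sset X \<longleftrightarrow>
     (\<forall>m. finite (cells X m)) \<and> (\<exists>M. \<forall>m\<ge>M. cells X m = {})"

definition nat_trans :: "'a aug_sset \<Rightarrow> 'b aug_sset \<Rightarrow> (nat \<Rightarrow> 'a \<Rightarrow> 'b) \<Rightarrow> bool" where
  "nat_trans X Y \<tau> \<longleftrightarrow>
     (\<forall>m. \<tau> m \<in> cells X m \<rightarrow> cells Y m) \<and>
     (\<forall>m n. \<forall>\<phi>\<in>Gam m n. \<forall>x\<in>cells X n. \<tau> m (face X m n \<phi> x) = face Y m n \<phi> (\<tau> n x))"

text \<open>
  Functors from the category of the sets \<open>{..<n}\<close> to augmented semi-simplicial sets:
  \<open>push Z n n' \<phi>\<close> is the natural transformation \<open>Z(\<phi>) : Z n \<rightarrow> Z n'\<close>, given by its components.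
\<close>

record 'b co_aug_sset =
  obj :: "nat \<Rightarrow> 'b aug_sset"
  push :: "nat \<Rightarrow> nat \<Rightarrow> (nat \<Rightarrow> nat) \<Rightarrow> nat \<Rightarrow> 'b \<Rightarrow> 'b"

definition is_co_aug_sset :: "'b co_aug_sset \<Rightarrow> bool" where
  "is_co_aug_sset Z \<longleftrightarrow>
     (\<forall>n. is_aug_sset (obj Z n)) \<and>
     (\<forall>n n'. \<forall>\<phi>\<in>Gam n n'. nat_trans (obj Z n) (obj Z n') (push Z n n' \<phi>)) \<and>
     (\<forall>n m. \<forall>z\<in>cells (obj Z n) m. push Z n n (Gam_id n) m z = z) \<and>
     (\<forall>l n n' m. \<forall>\<phi>\<in>Gam l n. \<forall>\<psi>\<in>Gam n n'. \<forall>z\<in>cells (obj Z l) m.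
        push Z l n' (compose {..<l} \<psi> \<phi>) m z = push Z n n' \<psi> m (push Z l n \<phi> m z))"

section \<open>The action as a colimit over the category of elements\<close>

definition elem_obj :: "'a aug_sset \<Rightarrow> (nat \<times> 'a) set" where
  "elem_obj X = Sigma UNIV (cells X)"

definition elem_mor :: "'a aug_sset \<Rightarrow> nat \<times> 'a \<Rightarrow> nat \<times> 'a \<Rightarrow> (nat \<Rightarrow> nat) set" where
  "elem_mor X e e' = {\<phi> \<in> Gam (fst e) (fst e'). face X (fst e) (fst e') \<phi> (snd e') = snd e}"

text \<open>
  Colimits of presheaves of sets are computed levelwise: level \<open>m\<close> of the colimit of the diagram
  \<open>e \<mapsto> Z (fst e)\<close> is the disjoint union of the sets \<open>Z (fst e)\<^sub>m\<close> modulo the equivalence relation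
  generated by \<open>(e, z) \<sim> (e', Z(\<phi>) z)\<close> for \<open>\<phi> : e \<rightarrow> e'\<close>. The universal property is
  \<open>act_universal\<close> below.
\<close>

definition act_pre :: "'a aug_sset \<Rightarrow> 'b co_aug_sset \<Rightarrow> nat \<Rightarrow> ((nat \<times> 'a) \<times> 'b) set" where
  "act_pre X Z m = Sigma (elem_obj X) (\<lambda>e. cells (obj Z (fst e)) m)"

definition act_gen ::
  "'a aug_sset \<Rightarrow> 'b co_aug_sset \<Rightarrow> nat \<Rightarrow> (((nat \<times> 'a) \<times> 'b) \<times> ((nat \<times> 'a) \<times> 'b)) set" where
  "act_gen X Z m =
     {((e, z), (e', push Z (fst e) (fst e') \<phi> m z)) | e e' \<phi> z.
        e \<in> elem_obj X \<and> e' \<in> elem_obj X \<and> \<phi> \<in> elem_mor X e e' \<and> z \<in> cells (obj Z (fst e)) m}"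

definition act_rel ::
  "'a aug_sset \<Rightarrow> 'b co_aug_sset \<Rightarrow> nat \<Rightarrow> (((nat \<times> 'a) \<times> 'b) \<times> ((nat \<times> 'a) \<times> 'b)) set" where
  "act_rel X Z m = (act_gen X Z m \<union> (act_gen X Z m)\<inverse>)\<^sup>* \<inter> act_pre X Z m \<times> act_pre X Z m"

definition act ::
  "'a aug_sset \<Rightarrow> 'b co_aug_sset \<Rightarrow> ((nat \<times> 'a) \<times> 'b) set aug_sset" (infixl "\<rhd>\<rhd>" 65) where
  "X \<rhd>\<rhd> Z =
     \<lparr>cells = (\<lambda>m. act_pre X Z m // act_rel X Z m),
      face = (\<lambda>m n \<theta> C. act_rel X Z m `` ((\<lambda>(e, z). (e, face (obj Z (fst e)) m n \<theta> z)) ` C))\<rparr>"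

section \<open>Subdivision\<close>

text \<open>
  A pair \<open>(K, f)\<close> in \<open>Sd_cells n m\<close> is a chain
  \<open>{} = K 0 \<rightarrow> K 1 \<rightarrow> \<dots> \<rightarrow> K m \<rightarrow> K (m + 1) = n\<close> with arrows \<open>f 0, \<dots>, f m\<close>. In the unshifted
  indexing, \<open>K (i + 1)\<close> is \<open>[k\<^sub>i]\<close>, and \<open>f 0, \<dots>, f m\<close> are \<open>\<phi>\<^sub>-\<^sub>1, \<phi>\<^sub>0, \<dots>\<close>. There is no such chain
  if \<open>m > n\<close>.
\<close>

type_synonym chain = "(nat \<Rightarrow> nat) \<times> (nat \<Rightarrow> nat \<Rightarrow> nat)"

definition Sd_cells :: "nat \<Rightarrow> nat \<Rightarrow> chain set" where
  "Sd_cells n m =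
     {(K, f). K \<in> extensional {..Suc m} \<and> f \<in> extensional {..m} \<and>
        K 0 = 0 \<and> strict_mono_on {..m} K \<and> K m \<le> n \<and> K (Suc m) = n \<and>
        (\<forall>i\<le>m. f i \<in> Gam (K i) (K (Suc i)))}"

primrec path_comp :: "(nat \<Rightarrow> nat) \<Rightarrow> (nat \<Rightarrow> nat \<Rightarrow> nat) \<Rightarrow> nat \<Rightarrow> nat \<Rightarrow> nat \<Rightarrow> nat" where
  "path_comp K f i 0 = Gam_id (K i)"
| "path_comp K f i (Suc l) = compose {..<K i} (f (i + l)) (path_comp K f i l)"

text \<open>
  A morphism \<open>\<theta>\<close> from \<open>p\<close> to \<open>m\<close> keeps the objects \<open>K (\<theta> i + 1)\<close> of a chain together with the two
  end points, and composes the arrows in between. For the morphism that omits \<open>i\<close> this is the face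
  \<open>d\<^sub>i\<close>, see \<open>Sd_face_coface\<close>.
\<close>

definition extend_idx :: "nat \<Rightarrow> nat \<Rightarrow> (nat \<Rightarrow> nat) \<Rightarrow> nat \<Rightarrow> nat" where
  "extend_idx p m \<theta> j = (if j = 0 then 0 else if j \<le> p then Suc (\<theta> (j - 1)) else Suc m)"

definition Sd_face :: "nat \<Rightarrow> nat \<Rightarrow> (nat \<Rightarrow> nat) \<Rightarrow> chain \<Rightarrow> chain" where
  "Sd_face p m \<theta> = (\<lambda>(K, f).
     let t = extend_idx p m \<theta> in
       (\<lambda>j\<in>{..Suc p}. K (t j), \<lambda>j\<in>{..p}. path_comp K f (t j) (t (Suc j) - t j)))"

definition Sd_push :: "nat \<Rightarrow> nat \<Rightarrow> (nat \<Rightarrow> nat) \<Rightarrow> nat \<Rightarrow> chain \<Rightarrow> chain" where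
  "Sd_push n n' \<psi> m = (\<lambda>(K, f). (K(Suc m := n'), f(m := compose {..<K m} \<psi> (f m))))"

definition Sd :: "chain co_aug_sset" where
  "Sd = \<lparr>obj = (\<lambda>n. \<lparr>cells = Sd_cells n, face = Sd_face\<rparr>), push = Sd_push\<rparr>"

definition Sd_ext :: "'a aug_sset \<Rightarrow> ((nat \<times> 'a) \<times> chain) set aug_sset" where
  "Sd_ext X = X \<rhd>\<rhd> Sd"

section \<open>Sequences and matrices\<close>

text \<open>
  \<^const>\<open>Sum_any\<close> sums over all indices with a nonzero summand, of which there must be finitely
  many; this is the case for all products below whose left factor has finite support.
\<close>

definition fin_supp :: "(nat \<Rightarrow> int) \<Rightarrow> bool" where
  "fin_supp a \<longleftrightarrow> finite {k. a k \<noteq> 0}"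

definition seq_mat :: "(nat \<Rightarrow> int) \<Rightarrow> (nat \<Rightarrow> nat \<Rightarrow> int) \<Rightarrow> nat \<Rightarrow> int" (infixl "\<cdot>\<^sub>m" 70) where
  "a \<cdot>\<^sub>m B = (\<lambda>j. Sum_any (\<lambda>k. a k * B k j))"

text \<open>The shift turns the entries \<open>(i + 1) choose (j + 1)\<close> of \<open>bin\<close> into \<open>i choose j\<close>.\<close>

definition bin :: "nat \<Rightarrow> nat \<Rightarrow> int" where
  "bin i j = int (i choose j)"

definition bin_inv :: "nat \<Rightarrow> nat \<Rightarrow> int" where
  "bin_inv i j = (-1) ^ (i - j) * int (i choose j)"

definition seq_act :: "(nat \<Rightarrow> int) \<Rightarrow> (nat \<Rightarrow> nat \<Rightarrow> int) \<Rightarrow> nat \<Rightarrow> int" (infixl "\<rhd>\<^sub>m" 70) where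
  "a \<rhd>\<^sub>m B = (a \<cdot>\<^sub>m bin_inv) \<cdot>\<^sub>m B"

definition seq_card :: "'a aug_sset \<Rightarrow> nat \<Rightarrow> int" where
  "seq_card X = (\<lambda>m. int (card (cells X m)))"

definition mat_card :: "'b co_aug_sset \<Rightarrow> nat \<Rightarrow> nat \<Rightarrow> int" where
  "mat_card Z = (\<lambda>n m. int (card (cells (obj Z n) m)))"

section \<open>Chain numbers\<close>

definition subset_chains :: "nat \<Rightarrow> nat \<Rightarrow> (nat \<Rightarrow> nat set) set" where
  "subset_chains n p =
     {N \<in> extensional {..p}. N 0 = {} \<and> (\<forall>i<p. N i \<subset> N (Suc i)) \<and> N p \<subseteq> {..<n}}"

definition cad :: "nat \<Rightarrow> nat \<Rightarrow> int" where
  "cad n p = int (card (subset_chains n p))"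

definition cad_breve :: "nat \<Rightarrow> nat \<Rightarrow> int" where
  "cad_breve n p = int (card {N \<in> subset_chains n p. N p = {..<n}})"

definition sd :: "nat \<Rightarrow> nat \<Rightarrow> int" where
  "sd = mat_card Sd"

definition sd_breve :: "nat \<Rightarrow> nat \<Rightarrow> int" where
  "sd_breve = cad_breve"

definition sd_seq :: "(nat \<Rightarrow> int) \<Rightarrow> nat \<Rightarrow> int" where
  "sd_seq a = a \<rhd>\<^sub>m cad"

section \<open>The constructions are well defined\<close>

lemma Gam_id: "Gam_id n \<in> Gam n n"
  by (auto simp: Gam_def Gam_id_def monotone_on_def)

lemma Gam_compose: "\<phi> \<in> Gam l m \<Longrightarrow> \<psi> \<in> Gam m n \<Longrightarrow> compose {..<l} \<psi> \<phi> \<in> Gam l n"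
  by (auto simp: Gam_def compose_def monotone_on_def PiE_iff)

lemma Gam_lt: "\<phi> \<in> Gam m n \<Longrightarrow> i < m \<Longrightarrow> \<phi> i < n"
  by (auto simp: Gam_def PiE_iff)

lemma Gam_mono: "\<phi> \<in> Gam m n \<Longrightarrow> i < j \<Longrightarrow> j < m \<Longrightarrow> \<phi> i < \<phi> j"
  by (auto simp: Gam_def monotone_on_def)

lemma Gam_le:
  assumes "\<phi> \<in> Gam m n"
  shows "m \<le> n"
proof -
  have "card {..<m} \<le> card {..<n}"
    using assms strict_mono_on_imp_inj_on[of "{..<m}" \<phi>]
    by (intro card_inj_on_le[of \<phi>]) (auto simp: Gam_def)
  then show ?thesis by simp
qed

lemma finite_Gam: "finite (Gam m n)"
  by (rule finite_subset[of _ "{..<m} \<rightarrow>\<^sub>E {..<n}"]) (auto simp: Gam_def intro: finite_PiE)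

lemma Gam_compose_assoc:
  assumes "\<phi> \<in> Gam k l"
  shows "compose {..<k} \<chi> (compose {..<k} \<psi> \<phi>) = compose {..<k} (compose {..<l} \<chi> \<psi>) \<phi>"
  using assms by (intro compose_assoc) (auto simp: Gam_def)

lemma Gam_id_left: "\<phi> \<in> Gam m n \<Longrightarrow> compose {..<m} (Gam_id n) \<phi> = \<phi>"
  unfolding Gam_id_def by (rule Id_compose[of _ _ "{..<n}"]) (auto simp: Gam_def PiE_def)

lemma Gam_id_right: "\<phi> \<in> Gam m n \<Longrightarrow> compose {..<m} \<phi> (Gam_id m) = \<phi>"
  unfolding Gam_id_def by (rule compose_Id[of _ _ "{..<n}"]) (auto simp: Gam_def PiE_def)

subsection \<open>Subdivision is a functor\<close>

lemma extend_idx_mono: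
  assumes "\<theta> \<in> Gam p m" "i < j" "j \<le> Suc p"
  shows "extend_idx p m \<theta> i < extend_idx p m \<theta> j"
  using assms Gam_mono[of \<theta> p m "i - 1" "j - 1"] Gam_lt[of \<theta> p m "i - 1"]
  by (auto simp: extend_idx_def)

lemma extend_idx_le:
  assumes "\<theta> \<in> Gam p m" "i \<le> p"
  shows "extend_idx p m \<theta> i \<le> m"
  using assms Gam_lt[of \<theta> p m "i - 1"] by (auto simp: extend_idx_def Suc_le_eq)

lemma extend_idx_0 [simp]: "extend_idx p m \<theta> 0 = 0"
  by (simp add: extend_idx_def)

lemma extend_idx_last [simp]: "extend_idx p m \<theta> (Suc p) = Suc m"
  by (simp add: extend_idx_def)

lemma extend_idx_le_Suc:
  assumes "\<theta> \<in> Gam p m" "i \<le> Suc p"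
  shows "extend_idx p m \<theta> i \<le> Suc m"
  using extend_idx_le[OF assms(1), of i] assms(2) by (cases "i = Suc p") auto

lemma extend_idx_id: "j \<le> Suc m \<Longrightarrow> extend_idx m m (Gam_id m) j = j"
  by (auto simp: extend_idx_def Gam_id_def)

lemma extend_idx_compose:
  assumes "\<eta> \<in> Gam q p" "\<theta> \<in> Gam p m"
  shows "extend_idx q m (compose {..<q} \<theta> \<eta>) j = extend_idx p m \<theta> (extend_idx q p \<eta> j)"
  using Gam_lt[OF assms(1), of "j - 1"] by (auto simp: extend_idx_def compose_def Suc_le_eq)

lemma path_comp_Gam:
  assumes "\<And>j. i \<le> j \<Longrightarrow> j < i + l \<Longrightarrow> f j \<in> Gam (K j) (K (Suc j))"
  shows "path_comp K f i l \<in> Gam (K i) (K (i + l))"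
  using assms by (induction l) (auto intro: Gam_id Gam_compose)

lemma path_comp_add:
  assumes "\<And>j. i \<le> j \<Longrightarrow> j < i + l \<Longrightarrow> f j \<in> Gam (K j) (K (Suc j))"
  shows "path_comp K f i (l + l') =
    compose {..<K i} (path_comp K f (i + l) l') (path_comp K f i l)"
proof -
  have g: "path_comp K f i l \<in> Gam (K i) (K (i + l))"
    using assms by (rule path_comp_Gam)
  show ?thesis
  proof (induction l')
    case 0
    show ?case using Gam_id_left[OF g] by simp
  next
    case (Suc l')
    show ?case
      using Gam_compose_assoc[OF g] by (simp add: Suc add.assoc)
  qed
qed

lemma path_comp_cong:
  assumes "K i = K' i" "\<And>j. i \<le> j \<Longrightarrow> j < i + l \<Longrightarrow> f j = f' j"
  shows "path_comp K f i l = path_comp K' f' i l"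
  using assms by (induction l) auto

lemma Sd_cellsD:
  assumes "(K, f) \<in> Sd_cells n m"
  shows "K \<in> extensional {..Suc m}" "f \<in> extensional {..m}" "K 0 = 0"
    "\<And>i j. i < j \<Longrightarrow> j \<le> m \<Longrightarrow> K i < K j" "K m \<le> n" "K (Suc m) = n"
    "\<And>i. i \<le> m \<Longrightarrow> f i \<in> Gam (K i) (K (Suc i))"
  using assms by (auto simp: Sd_cells_def monotone_on_def)

lemma Sd_cells_empty: "n < m \<Longrightarrow> Sd_cells n m = {}"
proof (rule ccontr)
  assume "n < m" "Sd_cells n m \<noteq> {}"
  then obtain K f where c: "(K, f) \<in> Sd_cells n m" by auto
  have "i \<le> m \<Longrightarrow> i \<le> K i" for i
  proof (induction i)
    case (Suc i)
    then show ?case using Sd_cellsD(4)[OF c, of i "Suc i"] by auto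
  qed simp
  from this[of m] Sd_cellsD(5)[OF c] \<open>n < m\<close> show False by simp
qed

lemma finite_Sd_cells: "finite (Sd_cells n m)"
proof -
  have "Sd_cells n m \<subseteq> ({..Suc m} \<rightarrow>\<^sub>E {..n}) \<times>
      ({..m} \<rightarrow>\<^sub>E (\<Union>i\<in>{..n}. \<Union>j\<in>{..n}. Gam i j))"
  proof clarify
    fix K f assume c: "(K, f) \<in> Sd_cells n m"
    have le: "K i \<le> n" if "i \<le> Suc m" for i
    proof (cases "i < m")
      case True
      then show ?thesis using Sd_cellsD(4)[OF c, of i m] Sd_cellsD(5)[OF c] by simp
    next
      case False
      with that have "i = m \<or> i = Suc m" by auto
      then show ?thesis using Sd_cellsD(5,6)[OF c] by auto
    qed
    have "f i \<in> (\<Union>i\<in>{..n}. \<Union>j\<in>{..n}. Gam i j)" if "i \<le> m" for i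
      using Sd_cellsD(7)[OF c that] le[of i] le[of "Suc i"] that by auto
    then show "K \<in> {..Suc m} \<rightarrow>\<^sub>E {..n} \<and> f \<in> {..m} \<rightarrow>\<^sub>E (\<Union>i\<in>{..n}. \<Union>j\<in>{..n}. Gam i j)"
      using Sd_cellsD(1,2)[OF c] le by (auto simp: PiE_iff)
  qed
  then show ?thesis
    by (rule finite_subset) (auto intro!: finite_cartesian_product finite_PiE finite_Gam)
qed

lemma Sd_face_cells:
  assumes t: "\<theta> \<in> Gam p m" and c: "(K, f) \<in> Sd_cells n m"
  shows "Sd_face p m \<theta> (K, f) \<in> Sd_cells n p"
proof -
  let ?t = "extend_idx p m \<theta>"
  have arrow: "path_comp K f (?t i) (?t (Suc i) - ?t i) \<in> Gam (K (?t i)) (K (?t (Suc i)))"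
    if "i \<le> p" for i
  proof -
    have lt: "?t i < ?t (Suc i)" using extend_idx_mono[OF t] that by simp
    have "?t (Suc i) \<le> Suc m" using extend_idx_le_Suc[OF t] that by simp
    with lt show ?thesis
      using path_comp_Gam[of "?t i" "?t (Suc i) - ?t i" f K] Sd_cellsD(7)[OF c] by auto
  qed
  have "K (?t p) \<le> n"
    using extend_idx_le[OF t, of p] Sd_cellsD(4)[OF c, of "?t p" m] Sd_cellsD(5)[OF c]
    by (cases "?t p = m") auto
  moreover have "strict_mono_on {..p} (\<lambda>j\<in>{..Suc p}. K (?t j))"
    using extend_idx_mono[OF t] extend_idx_le[OF t] Sd_cellsD(4)[OF c]
    by (auto simp: monotone_on_def)
  ultimately show ?thesis
    using Sd_cellsD(3,6)[OF c] arrow by (simp add: Sd_face_def Sd_cells_def Let_def)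
qed

lemma Sd_face_id:
  assumes c: "(K, f) \<in> Sd_cells n m"
  shows "Sd_face m m (Gam_id m) (K, f) = (K, f)"
proof -
  have "(\<lambda>j\<in>{..Suc m}. K (extend_idx m m (Gam_id m) j)) = K"
    using Sd_cellsD(1)[OF c] by (intro extensionalityI[of _ "{..Suc m}"]) (auto simp: extend_idx_id)
  moreover have "(\<lambda>j\<in>{..m}. path_comp K f (extend_idx m m (Gam_id m) j)
      (extend_idx m m (Gam_id m) (Suc j) - extend_idx m m (Gam_id m) j)) = f"
    using Sd_cellsD(2)[OF c]
    by (rule extensionalityI[OF restrict_extensional])
      (simp add: extend_idx_id Gam_id_right[OF Sd_cellsD(7)[OF c]])
  ultimately show ?thesis by (simp add: Sd_face_def Let_def)
qed

lemma Sd_face_compose: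
  assumes e: "\<eta> \<in> Gam q p" and t: "\<theta> \<in> Gam p m" and c: "(K, f) \<in> Sd_cells n m"
  shows "Sd_face q m (compose {..<q} \<theta> \<eta>) (K, f) = Sd_face q p \<eta> (Sd_face p m \<theta> (K, f))"
proof -
  let ?t = "extend_idx p m \<theta>" and ?e = "extend_idx q p \<eta>"
  define K' where "K' = (\<lambda>j\<in>{..Suc p}. K (?t j))"
  define f' where "f' = (\<lambda>j\<in>{..p}. path_comp K f (?t j) (?t (Suc j) - ?t j))"
  have path: "path_comp K' f' j l = path_comp K f (?t j) (?t (j + l) - ?t j)" if "j + l \<le> Suc p" for j l
    using that
  proof (induction l)
    case 0
    then show ?case by (simp add: K'_def)
  next
    case (Suc l)
    have le: "?t j \<le> ?t (j + l)" using extend_idx_mono[OF t, of j "j + l"] Suc.prems by (cases l) auto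
    have lt: "?t (j + l) < ?t (Suc (j + l))" using extend_idx_mono[OF t] Suc.prems by simp
    have top: "?t (Suc (j + l)) \<le> Suc m" using extend_idx_le_Suc[OF t] Suc.prems by simp
    have "path_comp K f (?t j) (?t (Suc (j + l)) - ?t j)
        = path_comp K f (?t j) ((?t (j + l) - ?t j) + (?t (Suc (j + l)) - ?t (j + l)))"
      using le lt by simp
    also have "\<dots> = compose {..<K (?t j)}
        (path_comp K f (?t (j + l)) (?t (Suc (j + l)) - ?t (j + l)))
        (path_comp K f (?t j) (?t (j + l) - ?t j))"
      using path_comp_add[of "?t j" "?t (j + l) - ?t j" f K "?t (Suc (j + l)) - ?t (j + l)"]
        Sd_cellsD(7)[OF c] le lt top by simp
    finally show ?case using Suc by (simp add: K'_def f'_def)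
  qed
  have "(\<lambda>j\<in>{..Suc q}. K (extend_idx q m (compose {..<q} \<theta> \<eta>) j)) = (\<lambda>j\<in>{..Suc q}. K' (?e j))"
    using extend_idx_le_Suc[OF e] by (intro restrict_ext) (auto simp: K'_def extend_idx_compose[OF e t])
  moreover have "(\<lambda>j\<in>{..q}. path_comp K f (extend_idx q m (compose {..<q} \<theta> \<eta>) j)
      (extend_idx q m (compose {..<q} \<theta> \<eta>) (Suc j) - extend_idx q m (compose {..<q} \<theta> \<eta>) j))
      = (\<lambda>j\<in>{..q}. path_comp K' f' (?e j) (?e (Suc j) - ?e j))"
  proof (intro restrict_ext)
    fix j assume "j \<in> {..q}"
    then have "?e j < ?e (Suc j)" "?e (Suc j) \<le> Suc p"
      using extend_idx_mono[OF e] extend_idx_le_Suc[OF e] by auto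
    then show "path_comp K f (extend_idx q m (compose {..<q} \<theta> \<eta>) j)
      (extend_idx q m (compose {..<q} \<theta> \<eta>) (Suc j) - extend_idx q m (compose {..<q} \<theta> \<eta>) j)
      = path_comp K' f' (?e j) (?e (Suc j) - ?e j)"
      using path[of "?e j" "?e (Suc j) - ?e j"] by (simp add: extend_idx_compose[OF e t])
  qed
  ultimately show ?thesis
    by (simp add: Sd_face_def Let_def K'_def f'_def)
qed

lemma Sd_face_coface:
  assumes c: "(K, f) \<in> Sd_cells n (Suc m)" and i: "i \<le> m"
  shows "Sd_face m (Suc m) (\<lambda>j\<in>{..<m}. if j < i then j else Suc j) (K, f) =
    (\<lambda>j\<in>{..Suc m}. if j \<le> i then K j else K (Suc j),
     \<lambda>j\<in>{..m}. if j < i then f j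
        else if j = i then compose {..<K i} (f (Suc i)) (f i) else f (Suc j))"
proof -
  let ?d = "\<lambda>j\<in>{..<m}. if j < i then j else Suc j"
  have t: "extend_idx m (Suc m) ?d j = (if j \<le> i then j else Suc j)" if "j \<le> Suc m" for j
    using that i by (auto simp: extend_idx_def)
  have "(\<lambda>j\<in>{..Suc m}. K (extend_idx m (Suc m) ?d j)) = (\<lambda>j\<in>{..Suc m}. if j \<le> i then K j else K (Suc j))"
    by (intro restrict_ext) (auto simp: t)
  moreover have "(\<lambda>j\<in>{..m}. path_comp K f (extend_idx m (Suc m) ?d j)
      (extend_idx m (Suc m) ?d (Suc j) - extend_idx m (Suc m) ?d j)) =
    (\<lambda>j\<in>{..m}. if j < i then f j
        else if j = i then compose {..<K i} (f (Suc i)) (f i) else f (Suc j))"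
    using i by (intro restrict_ext)
      (auto simp: t numeral_2_eq_2 Gam_id_right[OF Sd_cellsD(7)[OF c]])
  ultimately show ?thesis by (simp add: Sd_face_def Let_def del: restrict_apply)
qed

lemma Sd_push_cells:
  assumes p: "\<psi> \<in> Gam n n'" and c: "(K, f) \<in> Sd_cells n m"
  shows "Sd_push n n' \<psi> m (K, f) \<in> Sd_cells n' m"
proof -
  have "compose {..<K m} \<psi> (f m) \<in> Gam (K m) n'"
    using Gam_compose[OF _ p] Sd_cellsD(6,7)[OF c] by fastforce
  then show ?thesis
    using c Gam_le[OF p]
    by (auto simp: Sd_push_def Sd_cells_def monotone_on_def extensional_def)
qed

lemma Sd_push_face:
  assumes p: "\<psi> \<in> Gam n n'" and t: "\<theta> \<in> Gam q m" and c: "(K, f) \<in> Sd_cells n m"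
  shows "Sd_push n n' \<psi> q (Sd_face q m \<theta> (K, f)) = Sd_face q m \<theta> (Sd_push n n' \<psi> m (K, f))"
proof -
  let ?t = "extend_idx q m \<theta>" and ?K = "K(Suc m := n')" and ?f = "f(m := compose {..<K m} \<psi> (f m))"
  have "(\<lambda>j\<in>{..Suc q}. K (?t j))(Suc q := n') = (\<lambda>j\<in>{..Suc q}. ?K (?t j))"
  proof
    fix j show "((\<lambda>j\<in>{..Suc q}. K (?t j))(Suc q := n')) j = (\<lambda>j\<in>{..Suc q}. ?K (?t j)) j"
      using extend_idx_le[OF t, of j] by (cases "j = Suc q") auto
  qed
  moreover have "(\<lambda>j\<in>{..q}. path_comp K f (?t j) (?t (Suc j) - ?t j))
      (q := compose {..<K (?t q)} \<psi> (path_comp K f (?t q) (Suc m - ?t q)))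
    = (\<lambda>j\<in>{..q}. path_comp ?K ?f (?t j) (?t (Suc j) - ?t j))" (is "?L = ?R")
  proof
    fix j
    consider "j < q" | "j = q" | "j > q" by linarith
    then show "?L j = ?R j"
    proof cases
      case 1
      then have "?t (Suc j) \<le> m" "?t j < ?t (Suc j)"
        using extend_idx_le[OF t] extend_idx_mono[OF t] by auto
      then show ?thesis using 1 by (auto intro: path_comp_cong)
    next
      case 2
      have le: "?t q \<le> m" using extend_idx_le[OF t] by simp
      have eq: "path_comp K f (?t q) (m - ?t q) = path_comp ?K ?f (?t q) (m - ?t q)"
        using le by (intro path_comp_cong) auto
      have s: "Suc m - ?t q = Suc (m - ?t q)" using le by simp
      have g: "path_comp K f (?t q) (m - ?t q) \<in> Gam (K (?t q)) (K m)"
        using path_comp_Gam[of "?t q" "m - ?t q" f K] Sd_cellsD(7)[OF c] le by auto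
      show ?thesis
        using 2 le Gam_compose_assoc[OF g] by (simp add: s eq[symmetric])
    qed auto
  qed
  ultimately show ?thesis
    by (simp add: Sd_push_def Sd_face_def Let_def)
qed

lemma Sd_push_id:
  assumes c: "(K, f) \<in> Sd_cells n m"
  shows "Sd_push n n (Gam_id n) m (K, f) = (K, f)"
  using Sd_cellsD(6,7)[OF c] Gam_id_left[of "f m" "K m" n] by (auto simp: Sd_push_def)

lemma Sd_push_compose:
  assumes c: "(K, f) \<in> Sd_cells l m"
  shows "Sd_push l n' (compose {..<l} \<psi> \<phi>) m (K, f) = Sd_push n n' \<psi> m (Sd_push l n \<phi> m (K, f))"
  using Sd_cellsD(6,7)[OF c] Gam_compose_assoc[of "f m" "K m" l \<psi> \<phi>] by (auto simp: Sd_push_def)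

lemma is_co_aug_sset_Sd: "is_co_aug_sset Sd"
  unfolding is_co_aug_sset_def is_aug_sset_def nat_trans_def
  by (auto simp: Sd_def Sd_face_cells Sd_face_id Sd_face_compose Sd_push_cells Sd_push_face
      Sd_push_id Sd_push_compose)

subsection \<open>The action is a colimit of augmented semi-simplicial sets\<close>

locale action =
  fixes X :: "'a aug_sset" and Z :: "'b co_aug_sset"
  assumes X: "is_aug_sset X" and Z: "is_co_aug_sset Z"
begin

lemma push_cells:
  assumes "\<phi> \<in> Gam n n'" "z \<in> cells (obj Z n) m"
  shows "push Z n n' \<phi> m z \<in> cells (obj Z n') m"
  using assms Z unfolding is_co_aug_sset_def nat_trans_def by blast

lemma push_face:
  assumes "\<phi> \<in> Gam n n'" "\<theta> \<in> Gam p m" "z \<in> cells (obj Z n) m"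
  shows "push Z n n' \<phi> p (face (obj Z n) p m \<theta> z) = face (obj Z n') p m \<theta> (push Z n n' \<phi> m z)"
  using assms Z by (auto simp: is_co_aug_sset_def nat_trans_def)

lemma obj: "is_aug_sset (obj Z n)"
  using Z by (simp add: is_co_aug_sset_def)

lemma obj_face:
  assumes "\<theta> \<in> Gam p m" "z \<in> cells (obj Z n) m"
  shows "face (obj Z n) p m \<theta> z \<in> cells (obj Z n) p"
  using assms obj[of n] unfolding is_aug_sset_def by blast

lemma act_gen_sub: "act_gen X Z m \<subseteq> act_pre X Z m \<times> act_pre X Z m"
  by (auto simp: act_gen_def act_pre_def elem_mor_def intro: push_cells)

lemma equiv_act_rel: "equiv (act_pre X Z m) (act_rel X Z m)"
proof (rule equivI)
  have "sym ((act_gen X Z m \<union> (act_gen X Z m)\<inverse>)\<^sup>*)" by (intro sym_rtrancl sym_Un_converse)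
  then show "sym (act_rel X Z m)" unfolding act_rel_def sym_def by blast
  show "trans (act_rel X Z m)" unfolding act_rel_def by (auto intro!: transI)
qed (auto simp: act_rel_def refl_on_def)

lemma act_rel_induct:
  assumes "(u, v) \<in> act_rel X Z m"
    and refl: "\<And>u. u \<in> act_pre X Z m \<Longrightarrow> P u u"
    and sym: "\<And>u v. P u v \<Longrightarrow> P v u"
    and trans: "\<And>u v w. P u v \<Longrightarrow> P v w \<Longrightarrow> P u w"
    and gen: "\<And>u v. (u, v) \<in> act_gen X Z m \<Longrightarrow> P u v"
  shows "P u v"
proof -
  have "u \<in> act_pre X Z m" "(u, v) \<in> (act_gen X Z m \<union> (act_gen X Z m)\<inverse>)\<^sup>*"
    using assms(1) by (auto simp: act_rel_def)
  from this(2,1) show ?thesis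
  proof (induction rule: rtrancl_induct)
    case base
    then show ?case by (rule refl)
  next
    case (step v w)
    then have "P v w" using gen sym by blast
    with step show ?case using trans by blast
  qed
qed

lemma act_gen_rel: "(u, v) \<in> act_gen X Z m \<Longrightarrow> (u, v) \<in> act_rel X Z m"
  using act_gen_sub by (fastforce simp: act_rel_def)

abbreviation "level_face p m \<theta> \<equiv> \<lambda>(e, z). (e, face (obj Z (fst e)) p m \<theta> z)"

lemma level_face_pre:
  "\<theta> \<in> Gam p m \<Longrightarrow> u \<in> act_pre X Z m \<Longrightarrow> level_face p m \<theta> u \<in> act_pre X Z p"
  by (auto simp: act_pre_def intro: obj_face)

lemma level_face_rel:
  assumes t: "\<theta> \<in> Gam p m" and r: "(u, v) \<in> act_rel X Z m"
  shows "(level_face p m \<theta> u, level_face p m \<theta> v) \<in> act_rel X Z p"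
proof (rule act_rel_induct[OF r,
      where P = "\<lambda>u v. (level_face p m \<theta> u, level_face p m \<theta> v) \<in> act_rel X Z p"])
  fix u assume "u \<in> act_pre X Z m"
  then show "(level_face p m \<theta> u, level_face p m \<theta> u) \<in> act_rel X Z p"
    using level_face_pre[OF t] by (simp add: act_rel_def)
next
  fix u v assume "(level_face p m \<theta> u, level_face p m \<theta> v) \<in> act_rel X Z p"
  then show "(level_face p m \<theta> v, level_face p m \<theta> u) \<in> act_rel X Z p"
    using equiv_act_rel by (blast elim: equivE dest: symD)
next
  fix u v w
  assume "(level_face p m \<theta> u, level_face p m \<theta> v) \<in> act_rel X Z p"
    "(level_face p m \<theta> v, level_face p m \<theta> w) \<in> act_rel X Z p"
  then show "(level_face p m \<theta> u, level_face p m \<theta> w) \<in> act_rel X Z p"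
    using equiv_act_rel by (blast elim: equivE dest: transD)
next
  fix u v assume "(u, v) \<in> act_gen X Z m"
  then obtain e e' \<phi> z where uv: "u = (e, z)" "v = (e', push Z (fst e) (fst e') \<phi> m z)"
    "e \<in> elem_obj X" "e' \<in> elem_obj X" "\<phi> \<in> elem_mor X e e'" "z \<in> cells (obj Z (fst e)) m"
    by (auto simp: act_gen_def)
  have "((e, face (obj Z (fst e)) p m \<theta> z),
      (e', push Z (fst e) (fst e') \<phi> p (face (obj Z (fst e)) p m \<theta> z))) \<in> act_gen X Z p"
    using uv obj_face[OF t uv(6)] unfolding act_gen_def by blast
  moreover have "\<phi> \<in> Gam (fst e) (fst e')" using uv(5) by (simp add: elem_mor_def)
  ultimately show "(level_face p m \<theta> u, level_face p m \<theta> v) \<in> act_rel X Z p"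
    using uv push_face[OF _ t uv(6)] by (auto intro: act_gen_rel)
qed

lemma cells_act: "cells (X \<rhd>\<rhd> Z) m = act_pre X Z m // act_rel X Z m"
  by (simp add: act_def)

lemma class_cells: "u \<in> act_pre X Z m \<Longrightarrow> act_rel X Z m `` {u} \<in> cells (X \<rhd>\<rhd> Z) m"
  by (simp add: cells_act quotientI)

lemma face_class:
  assumes t: "\<theta> \<in> Gam p m" and u: "u \<in> act_pre X Z m"
  shows "face (X \<rhd>\<rhd> Z) p m \<theta> (act_rel X Z m `` {u}) = act_rel X Z p `` {level_face p m \<theta> u}"
proof -
  have "act_rel X Z p `` (level_face p m \<theta> ` (act_rel X Z m `` {u})) =
      act_rel X Z p `` {level_face p m \<theta> u}"
  proof -
    have *: "(u, u) \<in> act_rel X Z m" using u by (simp add: act_rel_def)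
    have "act_rel X Z p `` {level_face p m \<theta> v} = act_rel X Z p `` {level_face p m \<theta> u}"
      if "(u, v) \<in> act_rel X Z m" for v
      using equiv_class_eq[OF equiv_act_rel level_face_rel[OF t that]] by simp
    then have "(\<Union>v\<in>act_rel X Z m `` {u}. act_rel X Z p `` {level_face p m \<theta> v}) =
        act_rel X Z p `` {level_face p m \<theta> u}"
      using * by (intro SUP_eq_const) blast+
    moreover have "act_rel X Z p `` (level_face p m \<theta> ` (act_rel X Z m `` {u})) =
        (\<Union>v\<in>act_rel X Z m `` {u}. act_rel X Z p `` {level_face p m \<theta> v})"
      by blast
    ultimately show ?thesis by simp
  qed
  then show ?thesis by (simp add: act_def)
qed

lemma cells_actE:
  assumes "C \<in> cells (X \<rhd>\<rhd> Z) m"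
  obtains n x z where "x \<in> cells X n" "z \<in> cells (obj Z n) m" "C = act_rel X Z m `` {((n, x), z)}"
    "((n, x), z) \<in> act_pre X Z m"
  using assms by (auto simp: cells_act act_pre_def elem_obj_def elim!: quotientE)

lemma is_aug_sset_act: "is_aug_sset (X \<rhd>\<rhd> Z)"
  unfolding is_aug_sset_def
proof (intro conjI allI ballI funcsetI)
  fix m n \<phi> C assume t: "\<phi> \<in> Gam m n" and C: "C \<in> cells (X \<rhd>\<rhd> Z) n"
  from C obtain u where "u \<in> act_pre X Z n" "C = act_rel X Z n `` {u}" by (auto elim: cells_actE)
  then show "face (X \<rhd>\<rhd> Z) m n \<phi> C \<in> cells (X \<rhd>\<rhd> Z) m"
    using face_class[OF t] level_face_pre[OF t] class_cells by simp
next
  fix n C assume "C \<in> cells (X \<rhd>\<rhd> Z) n"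
  then obtain k x z where z: "z \<in> cells (obj Z k) n" "C = act_rel X Z n `` {((k, x), z)}"
    "((k, x), z) \<in> act_pre X Z n" by (rule cells_actE)
  have "face (obj Z k) n n (Gam_id n) z = z"
    using obj[of k] z(1) by (simp add: is_aug_sset_def)
  then show "face (X \<rhd>\<rhd> Z) n n (Gam_id n) C = C"
    using face_class[OF Gam_id z(3)] z(2) by simp
next
  fix l m n \<phi> \<psi> C
  assume p: "\<phi> \<in> Gam l m" "\<psi> \<in> Gam m n" and "C \<in> cells (X \<rhd>\<rhd> Z) n"
  then obtain k x z where z: "z \<in> cells (obj Z k) n" "C = act_rel X Z n `` {((k, x), z)}"
    "((k, x), z) \<in> act_pre X Z n" using cells_actE by metis
  have "face (obj Z k) l n (compose {..<l} \<psi> \<phi>) z = face (obj Z k) l m \<phi> (face (obj Z k) m n \<psi> z)"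
    using obj[of k] z(1) p unfolding is_aug_sset_def by blast
  then show "face (X \<rhd>\<rhd> Z) l n (compose {..<l} \<psi> \<phi>) C =
      face (X \<rhd>\<rhd> Z) l m \<phi> (face (X \<rhd>\<rhd> Z) m n \<psi> C)"
    using face_class[OF Gam_compose[OF p] z(3)] face_class[OF p(2) z(3)]
      face_class[OF p(1) level_face_pre[OF p(2) z(3)]] z(2) by simp
qed

definition inj_act :: "nat \<times> 'a \<Rightarrow> nat \<Rightarrow> 'b \<Rightarrow> ((nat \<times> 'a) \<times> 'b) set" where
  "inj_act e m z = act_rel X Z m `` {(e, z)}"

lemma inj_act_nat_trans:
  "e \<in> elem_obj X \<Longrightarrow> nat_trans (obj Z (fst e)) (X \<rhd>\<rhd> Z) (inj_act e)"
  by (auto simp: nat_trans_def inj_act_def face_class act_pre_def intro!: class_cells)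

lemma inj_act_cocone:
  assumes "e \<in> elem_obj X" "e' \<in> elem_obj X" "\<phi> \<in> elem_mor X e e'" "z \<in> cells (obj Z (fst e)) m"
  shows "inj_act e' m (push Z (fst e) (fst e') \<phi> m z) = inj_act e m z"
  unfolding inj_act_def
  by (rule equiv_class_eq[OF equiv_act_rel, symmetric], rule act_gen_rel)
    (use assms in \<open>unfold act_gen_def, blast\<close>)

theorem act_universal:
  fixes W :: "'c aug_sset"
  assumes nt: "\<And>e. e \<in> elem_obj X \<Longrightarrow> nat_trans (obj Z (fst e)) W (\<tau> e)"
    and cocone: "\<And>e e' \<phi> m z. e \<in> elem_obj X \<Longrightarrow> e' \<in> elem_obj X \<Longrightarrow> \<phi> \<in> elem_mor X e e' \<Longrightarrow>
      z \<in> cells (obj Z (fst e)) m \<Longrightarrow> \<tau> e' m (push Z (fst e) (fst e') \<phi> m z) = \<tau> e m z"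
  shows "\<exists>h. nat_trans (X \<rhd>\<rhd> Z) W h \<and>
      (\<forall>e\<in>elem_obj X. \<forall>m. \<forall>z\<in>cells (obj Z (fst e)) m. h m (inj_act e m z) = \<tau> e m z) \<and>
      (\<forall>h'. nat_trans (X \<rhd>\<rhd> Z) W h' \<and>
        (\<forall>e\<in>elem_obj X. \<forall>m. \<forall>z\<in>cells (obj Z (fst e)) m. h' m (inj_act e m z) = \<tau> e m z) \<longrightarrow>
        (\<forall>m. \<forall>C\<in>cells (X \<rhd>\<rhd> Z) m. h' m C = h m C))"
proof -
  define h where "h m C = (let u = SOME u. u \<in> C in \<tau> (fst u) m (snd u))" for m C
  have inv: "\<tau> (fst u) m (snd u) = \<tau> (fst v) m (snd v)" if "(u, v) \<in> act_rel X Z m" for u v m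
    by (rule act_rel_induct[OF that,
        where P = "\<lambda>u v. \<tau> (fst u) m (snd u) = \<tau> (fst v) m (snd v)"])
      (auto simp: act_gen_def dest: cocone)
  have h: "h m (act_rel X Z m `` {u}) = \<tau> (fst u) m (snd u)" if "u \<in> act_pre X Z m" for u m
  proof -
    have "u \<in> act_rel X Z m `` {u}" using that equiv_act_rel by (rule_tac equiv_class_self)
    then have "(SOME v. v \<in> act_rel X Z m `` {u}) \<in> act_rel X Z m `` {u}" by (rule someI)
    then show ?thesis using inv by (auto simp: h_def Let_def)
  qed
  have pre: "(e, z) \<in> act_pre X Z m \<longleftrightarrow> e \<in> elem_obj X \<and> z \<in> cells (obj Z (fst e)) m" for e z m
    by (auto simp: act_pre_def)
  have hi: "h m (inj_act e m z) = \<tau> e m z" if "e \<in> elem_obj X" "z \<in> cells (obj Z (fst e)) m" for e m z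
    using that h pre by (simp add: inj_act_def)
  have C: "\<exists>e z. e \<in> elem_obj X \<and> z \<in> cells (obj Z (fst e)) m \<and> C = inj_act e m z"
    if "C \<in> cells (X \<rhd>\<rhd> Z) m" for C m
  proof -
    from that obtain n x z where "x \<in> cells X n" "z \<in> cells (obj Z n) m"
      "C = act_rel X Z m `` {((n, x), z)}" by (rule cells_actE)
    then show ?thesis
      by (intro exI[of _ "(n, x)"] exI[of _ z]) (simp add: inj_act_def elem_obj_def)
  qed
  have "nat_trans (X \<rhd>\<rhd> Z) W h"
    unfolding nat_trans_def
  proof (intro conjI allI ballI funcsetI)
    fix m D assume "D \<in> cells (X \<rhd>\<rhd> Z) m"
    then show "h m D \<in> cells W m" using C[of D m] hi nt by (fastforce simp: nat_trans_def)
  next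
    fix p m \<theta> D assume t: "\<theta> \<in> Gam p m" and "D \<in> cells (X \<rhd>\<rhd> Z) m"
    then obtain e z where e: "e \<in> elem_obj X" "z \<in> cells (obj Z (fst e)) m" "D = inj_act e m z"
      using C by blast
    have "face (X \<rhd>\<rhd> Z) p m \<theta> D = inj_act e p (face (obj Z (fst e)) p m \<theta> z)"
      using inj_act_nat_trans[OF e(1)] t e by (auto simp: nat_trans_def)
    then show "h p (face (X \<rhd>\<rhd> Z) p m \<theta> D) = face W p m \<theta> (h m D)"
      using hi[OF e(1)] e obj_face[OF t e(2)] nt[OF e(1)] t by (auto simp: nat_trans_def)
  qed
  moreover have "h' m D = h m D"
    if "\<forall>e\<in>elem_obj X. \<forall>m. \<forall>z\<in>cells (obj Z (fst e)) m. h' m (inj_act e m z) = \<tau> e m z"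
      "D \<in> cells (X \<rhd>\<rhd> Z) m" for h' m D
    using C[OF that(2)] that(1) hi by metis
  ultimately show ?thesis using hi by (intro exI[of _ h]) auto
qed

end

lemma is_aug_sset_Sd_ext: "is_aug_sset X \<Longrightarrow> is_aug_sset (Sd_ext X)"
  unfolding Sd_ext_def by (rule action.is_aug_sset_act) (simp add: action_def is_co_aug_sset_Sd)

subsection \<open>The cardinals are those of finite sets\<close>

lemma finite_cells_Sd: "finite (cells (obj Sd n) m)"
  by (simp add: Sd_def finite_Sd_cells)

lemma finite_subset_chains: "finite (subset_chains n p)"
proof -
  have "N i \<subseteq> {..<n}" if "N \<in> subset_chains n p" "i \<le> p" for N i
    using that(2)
  proof (induction rule: inc_induct)
    case base
    then show ?case using that(1) by (simp add: subset_chains_def)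
  next
    case (step j)
    then show ?case using that(1) by (force simp: subset_chains_def)
  qed
  moreover have "N \<in> extensional {..p}" if "N \<in> subset_chains n p" for N
    using that by (simp add: subset_chains_def)
  ultimately have "subset_chains n p \<subseteq> {..p} \<rightarrow>\<^sub>E Pow {..<n}"
    by (intro subsetI PiE_I PowI) (auto simp: extensional_def)
  then show ?thesis by (rule finite_subset) (auto intro: finite_PiE)
qed

lemma finite_Sd_ext:
  assumes "finite_aug_sset X"
  shows "finite_aug_sset (Sd_ext X)"
proof -
  obtain M where M: "\<forall>m\<ge>M. cells X m = {}" and fin: "\<And>m. finite (cells X m)"
    using assms by (auto simp: finite_aug_sset_def)
  have "elem_obj X = Sigma {..<M} (cells X)"
    using M by (force simp: elem_obj_def not_le[symmetric])
  then have "finite (elem_obj X)" using fin by simp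
  then have "finite (act_pre X Sd m)" for m by (simp add: act_pre_def finite_cells_Sd)
  then have "finite (cells (Sd_ext X) m)" for m
    by (auto simp: Sd_ext_def act_def act_rel_def intro!: finite_quotient)
  moreover have "cells (Sd_ext X) m = {}" if "m \<ge> M" for m
  proof -
    have "act_pre X Sd m = {}"
    proof (rule ccontr)
      assume "act_pre X Sd m \<noteq> {}"
      then obtain n x c where nx: "x \<in> cells X n" "c \<in> Sd_cells n m"
        by (auto simp: act_pre_def elem_obj_def Sd_def)
      then have "m \<le> n" using Sd_cells_empty[of n m] by (auto simp: not_less[symmetric])
      then show False using nx M that by auto
    qed
    then show ?thesis by (simp add: Sd_ext_def act_def)
  qed
  ultimately show ?thesis by (auto simp: finite_aug_sset_def)
qed

lemma fin_supp_seq_card: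
  assumes "finite_aug_sset X"
  shows "fin_supp (seq_card X)"
proof -
  obtain M where M: "\<forall>m\<ge>M. cells X m = {}" using assms by (auto simp: finite_aug_sset_def)
  have "{k. seq_card X k \<noteq> 0} \<subseteq> {..<M}"
    using M by (auto simp: seq_card_def intro: leI)
  then show ?thesis unfolding fin_supp_def by (rule finite_subset) simp
qed

lemma fin_supp_bin_inv:
  assumes "fin_supp a"
  shows "fin_supp (a \<cdot>\<^sub>m bin_inv)"
proof -
  have fin: "finite {k. a k \<noteq> 0}" using assms by (simp add: fin_supp_def)
  have "{j. (a \<cdot>\<^sub>m bin_inv) j \<noteq> 0} \<subseteq> (\<Union>k\<in>{k. a k \<noteq> 0}. {..k})"
  proof
    fix j assume "j \<in> {j. (a \<cdot>\<^sub>m bin_inv) j \<noteq> 0}"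
    then have "\<exists>k. a k * bin_inv k j \<noteq> 0"
      unfolding seq_mat_def mem_Collect_eq using Sum_any.not_neutral_obtains_not_neutral by blast
    then show "j \<in> (\<Union>k\<in>{k. a k \<noteq> 0}. {..k})"
      by (auto simp: bin_inv_def)
  qed
  then show ?thesis unfolding fin_supp_def by (rule finite_subset) (use fin in auto)
qed

lemma bin_inv_inverse: "Sum_any (\<lambda>k. bin i k * bin_inv k j) = (if i = j then 1 else 0)"
proof -
  have "Sum_any (\<lambda>k. bin i k * bin_inv k j) = (\<Sum>k\<in>{..i}. bin i k * bin_inv k j)"
    by (rule Sum_any.expand_superset) (auto simp: bin_def intro: leI)
  also have "\<dots> = (\<Sum>k\<in>{j..i}. bin i k * bin_inv k j)"
    by (rule sum.mono_neutral_right) (auto simp: bin_inv_def)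
  also have "\<dots> = (if i = j then 1 else 0)"
  proof (cases "j \<le> i")
    case True
    have "(\<Sum>k\<in>{j..i}. bin i k * bin_inv k j) =
        (\<Sum>k\<in>{..i - j}. bin i (k + j) * bin_inv (k + j) j)"
      using True
      by (intro sum.reindex_bij_witness[of _ "\<lambda>k. k + j" "\<lambda>k. k - j"]) auto
    also have "\<dots> = (\<Sum>k\<in>{..i - j}. int (i choose j) * ((-1) ^ k * int ((i - j) choose k)))"
    proof (intro sum.cong refl)
      fix k assume "k \<in> {..i - j}"
      then have "(i choose (k + j)) * ((k + j) choose j) = (i choose j) * ((i - j) choose k)"
        using True choose_mult[of j "k + j" i] by auto
      then have "int (i choose (k + j)) * int ((k + j) choose j) =
          int (i choose j) * int ((i - j) choose k)"
        by (simp only: of_nat_mult[symmetric])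
      then show "bin i (k + j) * bin_inv (k + j) j =
          int (i choose j) * ((-1) ^ k * int ((i - j) choose k))"
        by (simp add: bin_def bin_inv_def algebra_simps)
    qed
    also have "\<dots> = int (i choose j) * (\<Sum>k\<le>i - j. (-1) ^ k * int ((i - j) choose k))"
      by (simp add: sum_distrib_left)
    also have "\<dots> = (if i = j then 1 else 0)"
      using True choose_alternating_sum[of "i - j", where 'a = int] by auto
    finally show ?thesis .
  qed auto
  finally show ?thesis .
qed

end

theory Submission
  imports Defs "HOL-Library.Infinite_Set"
begin

text \<open>
  A cell of \<open>Sd(X)\<close> is represented by an element \<open>x \<in> X\<^sub>n\<close> and a chain ending in \<open>[n]\<close>. Pulling \<open>x\<close>
  back along the last arrow of the chain makes this arrow an identity, and the resulting
  representative is unique. Hence \<open>|Sd(X)| = |X| \<cdot> B\<close>, where \<open>B\<close> counts the chains whose last arrow is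
  an identity. Dropping this identity and splitting off the arrow before it gives a recursion for \<open>B\<close> which the
  numbers of chains of subsets ending in the whole set satisfy as well. Splitting off the last
  arrow gives \<open>|Sd| = bin \<cdot> B\<close>, so that acting with \<open>|Sd|\<close> is multiplication by \<open>B\<close>.
\<close>

section \<open>Counting strictly increasing maps\<close>

text \<open>A strictly increasing map lists its image in increasing order, so it is determined by
  that image, and every \<open>k\<close>-element subset of \<open>{..<n}\<close> occurs as an
  image.\<close>

lemma card_Gam: "card (Gam k n) = n choose k"
proof -
  have "bij_betw (\<lambda>\<phi>. \<phi> ` {..<k}) (Gam k n) {S. S \<subseteq> {..<n} \<and> card S = k}"
  proof (rule bij_betwI')
    fix \<phi> \<psi> assume \<phi>: "\<phi> \<in> Gam k n" and \<psi>: "\<psi> \<in> Gam k n"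
    have sorted: "sorted (map \<chi> [0..<k])" "distinct (map \<chi> [0..<k])" if "\<chi> \<in> Gam k n" for \<chi>
      using Gam_mono[OF that] that strict_mono_on_imp_inj_on[of "{..<k}" \<chi>]
      by (auto simp: sorted_iff_nth_mono_less distinct_map Gam_def atLeast0LessThan less_imp_le)
    have "\<phi> = \<psi>" if "\<phi> ` {..<k} = \<psi> ` {..<k}"
    proof -
      have "map \<phi> [0..<k] = map \<psi> [0..<k]"
        using that sorted[OF \<phi>] sorted[OF \<psi>]
        by (intro sorted_distinct_set_unique) (auto simp: atLeast0LessThan)
      then have "\<phi> i = \<psi> i" if "i < k" for i
        using that by simp
      then show ?thesis
        using \<phi> \<psi> by (intro extensionalityI[of _ "{..<k}"]) (auto simp: Gam_def PiE_def)
    qed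
    then show "\<phi> ` {..<k} = \<psi> ` {..<k} \<longleftrightarrow> \<phi> = \<psi>" by blast
  next
    fix \<phi> assume "\<phi> \<in> Gam k n"
    then show "\<phi> ` {..<k} \<in> {S. S \<subseteq> {..<n} \<and> card S = k}"
      using strict_mono_on_imp_inj_on[of "{..<k}" \<phi>] by (auto simp: Gam_def card_image)
  next
    fix S assume S: "S \<in> {S. S \<subseteq> {..<n} \<and> card S = k}"
    then have "finite S" by (auto intro: finite_subset)
    then obtain h where h: "bij_betw h {..<card S} S" "strict_mono_on {..<card S} h"
      by (rule ex_bij_betw_strict_mono_card)
    have "restrict h {..<k} \<in> Gam k n" "S = restrict h {..<k} ` {..<k}"
      using h S by (auto simp: Gam_def bij_betw_def monotone_on_def)
    then show "\<exists>\<phi>\<in>Gam k n. S = \<phi> ` {..<k}" by blast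
  qed
  then show ?thesis
    using n_subsets[of "{..<n}" k] by (simp add: bij_betw_same_card)
qed

lemma Gam_self: "Gam n n = {Gam_id n}"
proof -
  have "card (Gam n n) = 1" by (simp add: card_Gam)
  then obtain \<phi> where "Gam n n = {\<phi>}" by (rule card_1_singletonE)
  then show ?thesis using Gam_id[of n] by simp
qed

section \<open>Chains of subsets\<close>

text \<open>This recursion is common to chains of subsets and chains of morphisms: \<open>k\<close>
  is the size of the last step but one. Its value counts the ordered partitions of an
  \<open>n\<close>-set into \<open>m\<close> nonempty blocks, that is, \<open>m!\<close> times a
  Stirling number of the second kind.\<close>

primrec chain_count :: "nat \<Rightarrow> nat \<Rightarrow> nat" where
  "chain_count 0 n = (if n = 0 then 1 else 0)"
| "chain_count (Suc m) n = (\<Sum>k<n. (n choose k) * chain_count m k)"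

text \<open>The top is an arbitrary set, since the induction passes to proper subsets, which need
  not be initial segments.\<close>

definition chains_to :: "'a set \<Rightarrow> nat \<Rightarrow> (nat \<Rightarrow> 'a set) set" where
  "chains_to A p = {N \<in> extensional {..p}. N 0 = {} \<and> (\<forall>i<p. N i \<subset> N (Suc i)) \<and> N p = A}"

lemma chains_to_0: "chains_to A 0 = (if A = {} then {\<lambda>i\<in>{..0}. {}} else {})"
  by (auto simp: chains_to_def extensional_def fun_eq_iff)

lemma bij_betw_chains_to_Suc:
  "bij_betw (\<lambda>N. N(Suc p := A)) (\<Union>S\<in>{S. S \<subset> A}. chains_to S p) (chains_to A (Suc p))"
proof (rule bij_betwI[where g = "\<lambda>N. restrict N {..p}"])
  show "(\<lambda>N. N(Suc p := A)) \<in> (\<Union>S\<in>{S. S \<subset> A}. chains_to S p) \<rightarrow> chains_to A (Suc p)"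
    by (auto simp: chains_to_def extensional_def less_Suc_eq)
  show "(\<lambda>N. restrict N {..p}) \<in> chains_to A (Suc p) \<rightarrow> (\<Union>S\<in>{S. S \<subset> A}. chains_to S p)"
    by (auto simp: chains_to_def)
  show "restrict (N(Suc p := A)) {..p} = N" if "N \<in> (\<Union>S\<in>{S. S \<subset> A}. chains_to S p)" for N
    using that by (auto simp: chains_to_def extensional_def fun_eq_iff)
  show "(restrict N {..p})(Suc p := A) = N" if "N \<in> chains_to A (Suc p)" for N
    using that by (auto simp: chains_to_def extensional_def fun_eq_iff)
qed

lemma sum_subsets_by_card:
  fixes g :: "nat \<Rightarrow> 'b::semiring_1"
  assumes "finite A" "finite T"
  shows "(\<Sum>S\<in>{S. S \<subseteq> A \<and> card S \<in> T}. g (card S)) = (\<Sum>k\<in>T. of_nat (card A choose k) * g k)"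
proof -
  have "(\<Sum>S\<in>{S. S \<subseteq> A \<and> card S \<in> T}. g (card S)) =
      (\<Sum>k\<in>T. \<Sum>S\<in>{S \<in> {S. S \<subseteq> A \<and> card S \<in> T}. card S = k}. g (card S))"
    using assms by (intro sum.group[symmetric]) auto
  also have "\<dots> = (\<Sum>k\<in>T. \<Sum>S\<in>{S. S \<subseteq> A \<and> card S = k}. g k)"
    by (intro sum.cong) auto
  finally show ?thesis using assms by (simp add: n_subsets)
qed

lemma card_chains_to:
  assumes "finite A"
  shows "finite (chains_to A p) \<and> card (chains_to A p) = chain_count p (card A)"
  using assms
proof (induction p arbitrary: A)
  case 0
  then show ?case by (auto simp: chains_to_0)
next
  case (Suc p)
  have fin: "finite S" if "S \<subset> A" for S
    using that Suc.prems by (auto intro: finite_subset)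
  have finite_psubsets: "finite {S. S \<subset> A}"
    by (rule finite_subset[of _ "Pow A"]) (use Suc.prems in auto)
  then have "finite (\<Union>S\<in>{S. S \<subset> A}. chains_to S p)"
    using Suc.IH fin finite_psubsets by auto
  \<comment> \<open>The union is disjoint because a chain determines its last member
    \<open>S = N p\<close>.\<close>
  moreover have "card (\<Union>S\<in>{S. S \<subset> A}. chains_to S p) = (\<Sum>S\<in>{S. S \<subset> A}. card (chains_to S p))"
    using Suc.IH fin finite_psubsets by (intro card_UN_disjoint) (auto simp: chains_to_def)
  moreover have "\<dots> = (\<Sum>S\<in>{S. S \<subseteq> A \<and> card S \<in> {..<card A}}. chain_count p (card S))"
    using Suc.IH fin Suc.prems by (intro sum.cong) (auto intro: psubset_card_mono)
  moreover have "\<dots> = chain_count (Suc p) (card A)"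
    using sum_subsets_by_card[of A "{..<card A}" "chain_count p"] Suc.prems by simp
  ultimately show ?case
    using bij_betw_chains_to_Suc[of p A] bij_betw_finite bij_betw_same_card by metis
qed

lemma cad_breve_eq: "cad_breve n p = int (chain_count p n)"
proof -
  have "{N \<in> subset_chains n p. N p = {..<n}} = chains_to {..<n} p"
    by (auto simp: subset_chains_def chains_to_def)
  then show ?thesis using card_chains_to[of "{..<n}" p] by (simp add: cad_breve_def)
qed

text \<open>Sort the chains by their last member; only its size matters for the number of chains
  below it.\<close>

lemma cad_eq: "cad n p = (\<Sum>k\<le>n. bin n k * cad_breve k p)"
proof -
  have "subset_chains n p = (\<Union>S\<in>Pow {..<n}. chains_to S p)"
    by (auto simp: subset_chains_def chains_to_def)
  moreover have "card (\<Union>S\<in>Pow {..<n}. chains_to S p) = (\<Sum>S\<in>Pow {..<n}. card (chains_to S p))"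
    using card_chains_to finite_subset[of _ "{..<n}"]
    by (intro card_UN_disjoint) (auto simp: chains_to_def)
  moreover have "\<dots> = (\<Sum>S\<in>{S. S \<subseteq> {..<n} \<and> card S \<in> {..n}}. chain_count p (card S))"
    using card_chains_to finite_subset[of _ "{..<n}"] card_mono[of "{..<n}"]
    by (intro sum.cong) auto
  moreover have "\<dots> = (\<Sum>k\<le>n. (n choose k) * chain_count p k)"
    using sum_subsets_by_card[of "{..<n}" "{..n}" "chain_count p"] by simp
  ultimately show ?thesis by (simp add: cad_def cad_breve_eq bin_def)
qed

section \<open>Chains of morphisms\<close>

text \<open>The last arrow of such a chain is an endomorphism in \<open>Gam n n\<close>, hence an
  identity. These chains serve as normal forms.\<close>

definition full_cells :: "nat \<Rightarrow> nat \<Rightarrow> chain set" where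
  "full_cells n m = {c \<in> Sd_cells n m. fst c m = n}"

definition core :: "nat \<Rightarrow> chain \<Rightarrow> chain" where
  "core m = (\<lambda>(K, f). (K(Suc m := K m), f(m := Gam_id (K m))))"

lemma core_full_cells:
  assumes "(K, f) \<in> Sd_cells n m"
  shows "core m (K, f) \<in> full_cells (K m) m"
  using assms Gam_id[of "K m"]
  by (auto simp: core_def full_cells_def Sd_cells_def monotone_on_def extensional_def)

lemma core_full:
  assumes "c \<in> full_cells n m"
  shows "core m c = c"
proof (cases c)
  case (Pair K f)
  then have c: "(K, f) \<in> Sd_cells n m" and n: "K m = n"
    using assms by (auto simp: full_cells_def)
  have "f m \<in> Gam n n" using Sd_cellsD(6,7)[OF c] n by fastforce
  then show ?thesis using Pair n Sd_cellsD(6)[OF c] by (auto simp: core_def Gam_self fun_upd_idem)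
qed

text \<open>Every chain is recovered by pushing its core forward along its last arrow. In the
  colimit this makes a chain equivalent to its core.\<close>

lemma push_core:
  assumes "(K, f) \<in> Sd_cells n m"
  shows "Sd_push (K m) n (f m) m (core m (K, f)) = (K, f)"
proof -
  have "f m \<in> Gam (K m) n" using Sd_cellsD(6,7)[OF assms] by fastforce
  then show ?thesis
    using Sd_cellsD(6)[OF assms] by (auto simp: core_def Sd_push_def Gam_id_right fun_upd_idem)
qed

text \<open>Pushing changes only the end point and the last arrow, exactly the data that
  \<open>core\<close> overwrites.\<close>

lemma core_push: "core m (Sd_push n n' \<psi> m c) = core m c"
  by (cases c) (simp add: core_def Sd_push_def)

text \<open>A chain amounts to its last inner object \<open>k\<close>, an arrow from
  \<open>k\<close> to \<open>n\<close>, and a full chain ending at \<open>k\<close>. Taking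
  \<open>T = {..n}\<close> counts all chains; \<open>T = {..<n}\<close> gives the recursion for full
  chains.\<close>

lemma card_Sd_cells_last:
  assumes "T \<subseteq> {..n}"
  shows "card {c \<in> Sd_cells n m. fst c m \<in> T} = (\<Sum>k\<in>T. (n choose k) * card (full_cells k m))"
proof -
  have fin: "finite T" using assms by (rule finite_subset) simp
  have "bij_betw (\<lambda>c. (fst c m, snd c m, core m c)) {c \<in> Sd_cells n m. fst c m \<in> T}
      (Sigma T (\<lambda>k. Gam k n \<times> full_cells k m))"
  proof (rule bij_betwI[where g = "\<lambda>(k, \<phi>, c). Sd_push k n \<phi> m c"])
    show "(\<lambda>c. (fst c m, snd c m, core m c)) \<in> {c \<in> Sd_cells n m. fst c m \<in> T} \<rightarrow>
        (Sigma T (\<lambda>k. Gam k n \<times> full_cells k m))"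
    proof
      fix c assume "c \<in> {c \<in> Sd_cells n m. fst c m \<in> T}"
      then obtain K f where c: "c = (K, f)" "(K, f) \<in> Sd_cells n m" "K m \<in> T"
        by (cases c) auto
      then show "(fst c m, snd c m, core m c) \<in> Sigma T (\<lambda>k. Gam k n \<times> full_cells k m)"
        using core_full_cells[OF c(2)] Sd_cellsD(6,7)[OF c(2)] by fastforce
    qed
    show "(\<lambda>(k, \<phi>, c). Sd_push k n \<phi> m c) \<in> Sigma T (\<lambda>k. Gam k n \<times> full_cells k m) \<rightarrow>
        {c \<in> Sd_cells n m. fst c m \<in> T}"
    proof clarify
      fix k \<phi> K f assume *: "k \<in> T" "\<phi> \<in> Gam k n" "(K, f) \<in> full_cells k m"
      then show "Sd_push k n \<phi> m (K, f) \<in> Sd_cells n m \<and> fst (Sd_push k n \<phi> m (K, f)) m \<in> T"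
        using Sd_push_cells[of \<phi> k n K f m] by (auto simp: full_cells_def Sd_push_def)
    qed
    show "(\<lambda>(k, \<phi>, c). Sd_push k n \<phi> m c) (fst c m, snd c m, core m c) = c"
      if "c \<in> {c \<in> Sd_cells n m. fst c m \<in> T}" for c
      using that push_core by (cases c) auto
    show "(\<lambda>c. (fst c m, snd c m, core m c)) ((\<lambda>(k, \<phi>, c). Sd_push k n \<phi> m c) t) = t"
      if "t \<in> Sigma T (\<lambda>k. Gam k n \<times> full_cells k m)" for t
    proof -
      obtain k \<phi> K f where t: "t = (k, \<phi>, (K, f))" by (cases t) auto
      with that have *: "\<phi> \<in> Gam k n" "(K, f) \<in> full_cells k m" by auto
      then have "(K, f) \<in> Sd_cells k m" "K m = k" by (auto simp: full_cells_def)
      \<comment> \<open>Pushing along \<phi> composes \<phi> with this identity, so \<phi> can be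
        read off as the new last arrow.\<close>
      then have "f m = Gam_id k"
        using Sd_cellsD(6,7)[of K f k m] Gam_self[of k] by fastforce
      then show ?thesis
        using t * core_full[OF *(2)] \<open>K m = k\<close> core_push[of m k n \<phi> "(K, f)"]
        by (auto simp: Sd_push_def Gam_id_right)
    qed
  qed
  then have "card {c \<in> Sd_cells n m. fst c m \<in> T} = card (Sigma T (\<lambda>k. Gam k n \<times> full_cells k m))"
    by (rule bij_betw_same_card)
  also have "\<dots> = (\<Sum>k\<in>T. card (Gam k n \<times> full_cells k m))"
    using fin finite_Gam finite_Sd_cells
    by (intro card_SigmaI) (auto simp: full_cells_def)
  finally show ?thesis by (simp add: card_cartesian_product card_Gam)
qed

text \<open>
  The last arrow of a full chain is an identity and can be dropped; the remaining chain is arbitrary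
  except that its last arrow is not an identity.
\<close>

lemma card_full_cells_Suc:
  "card (full_cells n (Suc m)) = card {c \<in> Sd_cells n m. fst c m \<in> {..<n}}"
proof -
  \<comment> \<open>At level \<open>Suc m\<close> the end point has index \<open>Suc (Suc m)\<close>
    and the last arrow has index \<open>Suc m\<close>; these two entries are dropped and
    restored.\<close>
  let ?h = "\<lambda>(K :: nat \<Rightarrow> nat, f :: nat \<Rightarrow> nat \<Rightarrow> nat). (restrict K {..Suc m}, restrict f {..m})"
  let ?g = "\<lambda>(K :: nat \<Rightarrow> nat, f). (K(Suc (Suc m) := n), f(Suc m := Gam_id n))"
  have "bij_betw ?h (full_cells n (Suc m)) {c \<in> Sd_cells n m. fst c m \<in> {..<n}}"
  proof (rule bij_betwI[where g = ?g])
    show "?h \<in> full_cells n (Suc m) \<rightarrow> {c \<in> Sd_cells n m. fst c m \<in> {..<n}}"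
    proof clarify
      fix K f assume "(K, f) \<in> full_cells n (Suc m)"
      then have c: "(K, f) \<in> Sd_cells n (Suc m)" and n: "K (Suc m) = n"
        by (auto simp: full_cells_def)
      have "K m < n" using Sd_cellsD(4)[OF c, of m "Suc m"] n by simp
      then show "(restrict K {..Suc m}, restrict f {..m}) \<in> Sd_cells n m \<and>
          fst (restrict K {..Suc m}, restrict f {..m}) m \<in> {..<n}"
        using Sd_cellsD(3,4,7)[OF c] n by (simp add: Sd_cells_def monotone_on_def)
    qed
    show "?g \<in> {c \<in> Sd_cells n m. fst c m \<in> {..<n}} \<rightarrow> full_cells n (Suc m)"
    proof clarify
      fix K f assume c: "(K, f) \<in> Sd_cells n m" and lt: "fst (K, f) m < n"
      have K: "K i < n" if "i \<le> m" for i
        using that lt Sd_cellsD(4)[OF c, of i m] by (cases "i = m") auto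
      have mono: "(K(Suc (Suc m) := n)) i < (K(Suc (Suc m) := n)) j" if "i < j" "j \<le> Suc m" for i j
        using that K Sd_cellsD(4,6)[OF c] by (cases "j = Suc m") auto
      show "(K(Suc (Suc m) := n), f(Suc m := Gam_id n)) \<in> full_cells n (Suc m)"
        using Sd_cellsD(1,2,3,6,7)[OF c] mono Gam_id[of n]
        by (auto simp: full_cells_def Sd_cells_def monotone_on_def extensional_def)
    qed
    show "?g (?h c) = c" if "c \<in> full_cells n (Suc m)" for c
    proof (cases c)
      case (Pair K f)
      with that have c: "(K, f) \<in> Sd_cells n (Suc m)" and n: "K (Suc m) = n"
        by (auto simp: full_cells_def)
      have "f (Suc m) = Gam_id n"
        using Sd_cellsD(6,7)[OF c] n Gam_self[of n] by fastforce
      then show ?thesis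
        using Pair Sd_cellsD(1,2,6)[OF c] by (auto simp: fun_eq_iff extensional_def le_Suc_eq)
    qed
    show "?h (?g c) = c" if "c \<in> {c \<in> Sd_cells n m. fst c m \<in> {..<n}}" for c
      using that by (cases c) (auto simp: Sd_cells_def fun_eq_iff extensional_def)
  qed
  then show ?thesis by (rule bij_betw_same_card)
qed

text \<open>At level \<open>0\<close> the initial object \<open>K 0 = 0\<close> is also the last
  inner one, which forces \<open>n = 0\<close> and leaves only the identity of the empty
  set.\<close>

lemma full_cells_0: "full_cells n 0 = (if n = 0 then {(\<lambda>i\<in>{..1}. 0, \<lambda>i\<in>{..0}. Gam_id 0)} else {})"
proof -
  have "(K, f) \<in> full_cells 0 0 \<longleftrightarrow> K = (\<lambda>i\<in>{..1}. 0) \<and> f = (\<lambda>i\<in>{..0}. Gam_id 0)" for K f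
  proof
    assume "(K, f) \<in> full_cells 0 0"
    then have "K \<in> extensional {..1}" "f \<in> extensional {..0}" "K 0 = 0" "K 1 = 0" "f 0 \<in> Gam 0 0"
      by (auto simp: full_cells_def Sd_cells_def)
    then show "K = (\<lambda>i\<in>{..1}. 0) \<and> f = (\<lambda>i\<in>{..0}. Gam_id 0)"
      by (auto simp: Gam_self extensional_def fun_eq_iff le_Suc_eq)
  next
    assume "K = (\<lambda>i\<in>{..1}. 0) \<and> f = (\<lambda>i\<in>{..0}. Gam_id 0)"
    then show "(K, f) \<in> full_cells 0 0"
      by (auto simp: full_cells_def Sd_cells_def Gam_id monotone_on_def)
  qed
  moreover have "n = 0" if "c \<in> full_cells n 0" for c
    using that by (auto simp: full_cells_def Sd_cells_def)
  ultimately show ?thesis by auto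
qed

lemma card_full_cells: "card (full_cells n m) = chain_count m n"
proof (induction m arbitrary: n)
  case 0
  then show ?case by (simp add: full_cells_0)
next
  case (Suc m)
  have "card (full_cells n (Suc m)) = (\<Sum>k<n. (n choose k) * card (full_cells k m))"
    unfolding card_full_cells_Suc by (rule card_Sd_cells_last) auto
  then show ?case by (simp add: Suc)
qed

lemma mat_card_Sd: "mat_card Sd = cad"
proof (intro ext)
  fix n m
  have "{c \<in> Sd_cells n m. fst c m \<in> {..n}} = Sd_cells n m"
    by (auto simp: Sd_cells_def)
  then have "card (Sd_cells n m) = (\<Sum>k\<le>n. (n choose k) * chain_count m k)"
    using card_Sd_cells_last[of "{..n}" n m] by (simp add: card_full_cells)
  then show "mat_card Sd n m = cad n m"
    by (simp add: mat_card_def Sd_def cad_eq cad_breve_eq bin_def)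
qed

section \<open>The cells of the subdivision\<close>

text \<open>Each class contains exactly one pair with a full chain: the normal form
  \<open>nf u\<close> is related to \<open>u\<close>, is constant on classes, and fixes the pairs
  with a full chain.\<close>

lemma bij_betw_act_Sd:
  assumes X: "is_aug_sset X"
  shows "bij_betw (\<lambda>u. act_rel X Sd m `` {u}) (Sigma (elem_obj X) (\<lambda>e. full_cells (fst e) m))
    (cells (X \<rhd>\<rhd> Sd) m)"
proof -
  interpret action X Sd using X is_co_aug_sset_Sd by unfold_locales
  let ?T = "Sigma (elem_obj X) (\<lambda>e. full_cells (fst e) m)"
  define nf where "nf = (\<lambda>((n, x), c). ((fst c m, face X (fst c m) n (snd c m) x), core m c))"
  have T_pre: "?T \<subseteq> act_pre X Sd m"
    by (auto simp: act_pre_def Sd_def full_cells_def)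
  have last: "f m \<in> Gam (K m) n" if "(K, f) \<in> Sd_cells n m" for K f n
    using Sd_cellsD(6,7)[OF that] by fastforce
  have nf_T: "nf u \<in> ?T" and nf_rel: "(nf u, u) \<in> act_rel X Sd m" if u_pre: "u \<in> act_pre X Sd m" for u
  proof -
    obtain n x K f where u: "u = ((n, x), (K, f))" by (cases u) auto
    with u_pre have c: "(K, f) \<in> Sd_cells n m" and x: "x \<in> cells X n"
      by (auto simp: act_pre_def Sd_def elem_obj_def)
    let ?y = "face X (K m) n (f m) x"
    have y: "?y \<in> cells X (K m)"
      using X last[OF c] x unfolding is_aug_sset_def by blast
    show "nf u \<in> ?T"
      using y core_full_cells[OF c] by (simp add: nf_def u elem_obj_def)
    \<comment> \<open>One generator suffices: the last arrow is a morphism of elements from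
      \<open>?y\<close> to \<open>x\<close>, and it pushes the core to the given chain.\<close>
    have "(nf u, u) \<in> act_gen X Sd m"
      unfolding act_gen_def mem_Collect_eq
    proof (intro exI conjI)
      show "(nf u, u) = (((K m, ?y), core m (K, f)),
          ((n, x), push Sd (fst (K m, ?y)) (fst (n, x)) (f m) m (core m (K, f))))"
        using push_core[OF c] by (simp add: u nf_def Sd_def)
      show "core m (K, f) \<in> cells (obj Sd (fst (K m, ?y))) m"
        using core_full_cells[OF c] by (simp add: Sd_def full_cells_def)
    qed (use x y last[OF c] in \<open>auto simp: elem_obj_def elem_mor_def\<close>)
    then show "(nf u, u) \<in> act_rel X Sd m" by (rule act_gen_rel)
  qed
  have nf_id: "nf u = u" if u_T: "u \<in> ?T" for u
  proof -
    obtain n x K f where u: "u = ((n, x), (K, f))" by (cases u) auto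
    with u_T have c: "(K, f) \<in> full_cells n m" "(K, f) \<in> Sd_cells n m" "K m = n" "x \<in> cells X n"
      by (auto simp: full_cells_def elem_obj_def)
    then have "f m = Gam_id n" using last[OF c(2)] Gam_self[of n] by auto
    then show ?thesis
      using u c core_full[OF c(1)] X by (simp add: nf_def is_aug_sset_def)
  qed
  have nf_gen: "nf u = nf v" if uv: "(u, v) \<in> act_gen X Sd m" for u v
  proof -
    obtain n x n' x' \<psi> K f where u: "u = ((n, x), (K, f))"
        and v: "v = ((n', x'), Sd_push n n' \<psi> m (K, f))"
        and x: "x' \<in> cells X n'" "\<psi> \<in> Gam n n'" "face X n n' \<psi> x' = x"
        and c: "(K, f) \<in> Sd_cells n m"
      using uv by (fastforce simp: act_gen_def elem_obj_def elem_mor_def Sd_def)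
    \<comment> \<open>The pushed chain has last arrow \<psi> after \<open>f m\<close>; functoriality
      of \<open>X\<close> shows that pulling \<open>x'\<close> back along it agrees with pulling
      \<open>x\<close> back along \<open>f m\<close>.\<close>
    have "face X (K m) n' (compose {..<K m} \<psi> (f m)) x' = face X (K m) n (f m) (face X n n' \<psi> x')"
      using X last[OF c] x unfolding is_aug_sset_def by blast
    then show ?thesis
      using core_push[of m n n' \<psi> "(K, f)"] x(3) by (simp add: nf_def u v) (simp add: Sd_push_def)
  qed
  have nf_inv: "nf u = nf v" if "(u, v) \<in> act_rel X Sd m" for u v
    using that by (rule act_rel_induct[where P = "\<lambda>u v. nf u = nf v"]) (auto intro: nf_gen)
  show ?thesis
  proof (rule bij_betwI')
    fix u v assume u: "u \<in> ?T" and v: "v \<in> ?T"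
    have "u = v" if "act_rel X Sd m `` {u} = act_rel X Sd m `` {v}"
    proof -
      have "v \<in> act_pre X Sd m" using v T_pre by blast
      then have "(u, v) \<in> act_rel X Sd m" by (rule eq_equiv_class[OF that equiv_act_rel])
      then have "nf u = nf v" by (rule nf_inv)
      then show ?thesis using nf_id[OF u] nf_id[OF v] by simp
    qed
    then show "act_rel X Sd m `` {u} = act_rel X Sd m `` {v} \<longleftrightarrow> u = v" by blast
  next
    fix u assume "u \<in> ?T"
    then show "act_rel X Sd m `` {u} \<in> cells (X \<rhd>\<rhd> Sd) m" using T_pre class_cells by blast
  next
    fix C assume "C \<in> cells (X \<rhd>\<rhd> Sd) m"
    then obtain u where u: "u \<in> act_pre X Sd m" "C = act_rel X Sd m `` {u}"
      by (auto elim: cells_actE)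
    then have "C = act_rel X Sd m `` {nf u}"
      using equiv_class_eq[OF equiv_act_rel nf_rel] by simp
    then show "\<exists>u\<in>?T. C = act_rel X Sd m `` {u}" using nf_T[OF u(1)] by (rule bexI)
  qed
qed

text \<open>By the normal forms, each element of \<open>cells X n\<close> contributes one cell for
  every full chain ending at \<open>n\<close>.\<close>

lemma seq_card_act_Sd:
  assumes X: "is_aug_sset X" and fin: "finite_aug_sset X"
  shows "seq_card (X \<rhd>\<rhd> Sd) = seq_card X \<cdot>\<^sub>m cad_breve"
proof
  fix m
  obtain M where M: "\<forall>m\<ge>M. cells X m = {}" and fin: "\<And>m. finite (cells X m)"
    using fin by (auto simp: finite_aug_sset_def)
  have e: "elem_obj X = Sigma {..<M} (cells X)"
    using M by (force simp: elem_obj_def not_le[symmetric])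
  have "card (cells (X \<rhd>\<rhd> Sd) m) = card (Sigma (elem_obj X) (\<lambda>e. full_cells (fst e) m))"
    using bij_betw_same_card[OF bij_betw_act_Sd[OF X]] by simp
  also have "\<dots> = (\<Sum>e\<in>elem_obj X. chain_count m (fst e))"
    using fin finite_Sd_cells by (subst card_SigmaI) (auto simp: e full_cells_def card_full_cells[symmetric])
  also have "\<dots> = (\<Sum>n<M. \<Sum>x\<in>cells X n. chain_count m n)"
    unfolding e using fin by (subst sum.Sigma) (auto simp: case_prod_beta)
  finally have "seq_card (X \<rhd>\<rhd> Sd) m = (\<Sum>n<M. seq_card X n * cad_breve n m)"
    by (simp add: seq_card_def cad_breve_eq)
  also have "\<dots> = (seq_card X \<cdot>\<^sub>m cad_breve) m"
    unfolding seq_mat_def using M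
    by (intro Sum_any.expand_superset[symmetric]) (auto simp: seq_card_def intro: leI)
  finally show "seq_card (X \<rhd>\<rhd> Sd) m = (seq_card X \<cdot>\<^sub>m cad_breve) m" .
qed

section \<open>Binomial inversion\<close>

text \<open>
  The matrices \<open>bin\<close> and \<open>bin_inv\<close> are conjugate under the diagonal matrix with entries \<open>(-1) ^ i\<close>, so a
  right inverse of \<open>bin\<close> is also a left inverse.
\<close>

lemma bin_inv_left_inverse:
  assumes "i < M"
  shows "(\<Sum>k<M. bin_inv i k * bin k j) = (if i = j then 1 else 0)"
proof -
  have sign: "bin_inv i j = (-1) ^ i * (-1) ^ j * bin i j" for i j
  proof (cases "j \<le> i")
    case True
    then have "(-1 :: int) ^ (i - j) = (-1) ^ i * (-1) ^ j"
      by (simp add: power_add[symmetric] uminus_power_if)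
    then show ?thesis by (simp add: bin_inv_def bin_def)
  qed (simp add: bin_inv_def bin_def)
  have "(\<Sum>k<M. bin_inv i k * bin k j) = (\<Sum>k<M. (-1) ^ i * (-1) ^ j * (bin i k * bin_inv k j))"
  proof (intro sum.cong refl)
    fix k
    have "(-1) ^ i * (-1) ^ j * (bin i k * bin_inv k j) =
        bin_inv i k * bin k j * ((-1) ^ j * (-1) ^ j)"
      unfolding sign by (simp only: mult_ac)
    also have "(-1 :: int) ^ j * (-1) ^ j = 1" by (simp flip: power_mult_distrib)
    finally show "bin_inv i k * bin k j = (-1) ^ i * (-1) ^ j * (bin i k * bin_inv k j)" by simp
  qed
  also have "\<dots> = (-1) ^ i * (-1) ^ j * (\<Sum>k<M. bin i k * bin_inv k j)"
    by (simp add: sum_distrib_left)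
  also have "(\<Sum>k<M. bin i k * bin_inv k j) = (if i = j then 1 else 0)"
    \<comment> \<open>Since \<open>i < M\<close>, cutting the sum off at \<open>M\<close> loses only
      terms with \<open>bin i k = 0\<close>.\<close>
    using assms bin_inv_inverse[of i j]
    by (subst (asm) Sum_any.expand_superset[of "{..<M}"]) (auto simp: bin_def not_le intro!: leI)
  finally show ?thesis by (simp flip: power_mult_distrib)
qed

text \<open>As \<open>B\<close> is the product of \<open>bin\<close> and \<open>C\<close>,
  associativity cancels \<open>bin_inv\<close> against \<open>bin\<close>. A common bound
  \<open>M\<close> on all supports makes the sums finite, so they may be interchanged.\<close>

lemma seq_act_bin:
  assumes "fin_supp a" and B: "\<And>n j. B n j = (\<Sum>k\<le>n. bin n k * C k j)"
  shows "a \<rhd>\<^sub>m B = a \<cdot>\<^sub>m C"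
proof
  fix j
  obtain M where M: "\<And>k. a k \<noteq> 0 \<Longrightarrow> k < M"
    using assms(1) unfolding fin_supp_def finite_nat_set_iff_bounded by auto
  have mat: "(b \<cdot>\<^sub>m D) j = (\<Sum>k<M. b k * D k j)" if "\<And>k. b k \<noteq> 0 \<Longrightarrow> k < M" for b D j
    unfolding seq_mat_def using that by (intro Sum_any.expand_superset) auto
  have ab: "(a \<cdot>\<^sub>m bin_inv) k = (\<Sum>i<M. a i * bin_inv i k)" for k
    by (rule mat) (rule M)
  \<comment> \<open>Since \<open>bin_inv\<close> is lower triangular, multiplying by it keeps the
    support below the same bound \<open>M\<close>.\<close>
  have "(a \<cdot>\<^sub>m bin_inv) k = 0" if "M \<le> k" for k
    unfolding ab using that by (intro sum.neutral) (auto simp: bin_inv_def)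
  then have "k < M" if "(a \<cdot>\<^sub>m bin_inv) k \<noteq> 0" for k
    using that not_le by blast
  then have "(a \<rhd>\<^sub>m B) j = (\<Sum>n<M. (\<Sum>i<M. a i * bin_inv i n) * B n j)"
    unfolding seq_act_def by (subst mat) (auto simp: ab)
  also have "\<dots> = (\<Sum>n<M. (\<Sum>i<M. a i * bin_inv i n) * (\<Sum>k<M. bin n k * C k j))"
  proof (intro sum.cong refl arg_cong2[where f = "(*)"])
    fix n assume "n \<in> {..<M}"
    then show "B n j = (\<Sum>k<M. bin n k * C k j)"
      unfolding B by (intro sum.mono_neutral_left) (auto simp: bin_def)
  qed
  also have "\<dots> = (\<Sum>n<M. \<Sum>i<M. \<Sum>k<M. a i * (bin_inv i n * bin n k) * C k j)"
    by (simp add: sum_product mult.assoc)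
  also have "\<dots> = (\<Sum>i<M. \<Sum>n<M. \<Sum>k<M. a i * (bin_inv i n * bin n k) * C k j)"
    by (rule sum.swap)
  also have "\<dots> = (\<Sum>i<M. \<Sum>k<M. \<Sum>n<M. a i * (bin_inv i n * bin n k) * C k j)"
    by (intro sum.cong refl sum.swap)
  also have "\<dots> = (\<Sum>i<M. \<Sum>k<M. a i * (\<Sum>n<M. bin_inv i n * bin n k) * C k j)"
    by (simp add: sum_distrib_left sum_distrib_right)
  also have "\<dots> = (\<Sum>i<M. \<Sum>k<M. if i = k then a i * C k j else 0)"
    by (intro sum.cong refl) (auto simp: bin_inv_left_inverse)
  also have "\<dots> = (\<Sum>i<M. a i * C i j)"
    by simp
  also have "\<dots> = (a \<cdot>\<^sub>m C) j"
    using M by (simp add: mat)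
  finally show "(a \<rhd>\<^sub>m B) j = (a \<cdot>\<^sub>m C) j" .
qed

theorem mainTheorem1:
  fixes X :: "'a aug_sset" and a :: "nat \<Rightarrow> int"
  assumes "is_aug_sset X" and "finite_aug_sset X" and "fin_supp a"
  shows "(seq_card (Sd_ext X) = seq_card (X \<rhd>\<rhd> Sd) \<and>
          seq_card (X \<rhd>\<rhd> Sd) = seq_card X \<rhd>\<^sub>m mat_card Sd) \<and>
         (sd = mat_card Sd \<and> mat_card Sd = cad) \<and>
         (sd_seq a = a \<rhd>\<^sub>m sd \<and> a \<rhd>\<^sub>m sd = a \<cdot>\<^sub>m sd_breve) \<and>
         seq_card (Sd_ext X) = sd_seq (seq_card X)"
proof -
  \<comment> \<open>This is applied twice: to \<open>a\<close>, and to the sequential cardinal of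
    \<open>X\<close>, whose support is finite.\<close>
  have act: "b \<rhd>\<^sub>m cad = b \<cdot>\<^sub>m cad_breve" if "fin_supp b" for b
    using that cad_eq by (rule seq_act_bin)
  show ?thesis
    using seq_card_act_Sd[OF assms(1,2)] act[OF fin_supp_seq_card[OF assms(2)]] act[OF assms(3)]
    by (simp add: Sd_ext_def sd_def sd_breve_def sd_seq_def mat_card_Sd)
qed

end
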